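(* Let $\Gamma$ be an arbitrary regular graph of degree $k\ge 2$ (not necessarily simple) with a distinguished vertex $o$, and let $\tilde\varrho=\tilde\varrho(\Gamma,o)$ and $\gamma^*=\gamma^*(\Gamma,o)$. Then $$\gamma^*\le\frac{\tilde\varrho+\sqrt{\tilde\varrho^2-4(k-1)}}{2}.$$ If, in addition, $\tilde\varrho>2\sqrt{k-1}$ (e.g. when $\Gamma$ is vertex-transitive and simple and is not a tree), then the estimate becomes an identity: $$\gamma^*=\frac{\tilde\varrho+\sqrt{\tilde\varrho^2-4(k-1)}}{2}.$$
   Context: Graphs are undirected; a graph that is not simple may have loops and multiple edges. For graphs which are not simple, paths are considered as sequences of edges rather than of vertices, so two paths passing through the same vertices in the same order but through different edges are distinct. Paths and cycles may use vertices and edges more than once. A graph is vertex-transitive if its automorphism group acts transitively on its set of vertices. For $n\in\mathbb{N}$ (with $0\in\mathbb{N}$): - $C_n(\Gamma,o)$ is the number of oriented cycles of length $n$ in $\Gamma$ starting from $o$ (i.e. closed paths from $o$ to $o$, with repetitions of vertices and edges allowed); - $a^*_n(\Gamma,o)$ is the number of oriented cycles of length $n$ in $\Gamma$ starting from $o$ without backtracks, i.e. without pairs of consecutive passes through the same edge of $\Gamma$, forth and back. Backtracks are not regarded cyclically: passing the same edge first and last is not a backtrack. Define $$\tilde\varrho(\Gamma,o)=\limsup_{n\to\infty}\sqrt[n]{C_n(\Gamma,o)},\qquad \gamma^*(\Gamma,o)=\limsup_{n\to\infty}\sqrt[n]{a^*_n(\Gamma,o)}.$$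
   Formalization: The parenthetical example fails for finite cycles (k=2) and for disjoint unions of trees; there Γ is also assumed connected, and ϱ̃>2√(k−1) is claimed only for k≠2, while the identity is proved for k=2 too. Loops count 2 in the degree and have two passes. *)

theory Defs
  imports
    Complex_Main
    "HOL-Library.Extended_Real"
    "HOL-Library.Liminf_Limsup"
    "Graph_Theory.Graph_Theory"
begin

text \<open>
  An undirected graph, possibly infinite and possibly with loops and multiple edges, is a
  \<^locale>\<open>bidirected_digraph\<close>: every undirected edge is a pair of mutually reverse arcs
  \<open>a\<close>, \<open>arev a\<close>, its two passes. The reversal has no fixed points on arcs, so a loop has two
  passes as well and contributes 2 to the degree \<^const>\<open>out_degree\<close> of its vertex.
  Paths are the arc walks \<^const>\<open>pre_digraph.awalk\<close>, i.e. lists of arcs.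
\<close>

definition regular_graph :: "('a, 'b) pre_digraph \<Rightarrow> ('b \<Rightarrow> 'b) \<Rightarrow> nat \<Rightarrow> bool" where
  "regular_graph G arev k \<longleftrightarrow>
    bidirected_digraph G arev \<and> (\<forall>v\<in>verts G. finite (out_arcs G v) \<and> out_degree G v = k)"

definition backtrack_free :: "('b \<Rightarrow> 'b) \<Rightarrow> 'b awalk \<Rightarrow> bool" where
  "backtrack_free arev p \<longleftrightarrow> (\<forall>i. Suc i < length p \<longrightarrow> p ! Suc i \<noteq> arev (p ! i))"

definition num_cycles :: "('a, 'b) pre_digraph \<Rightarrow> 'a \<Rightarrow> nat \<Rightarrow> nat" where
  "num_cycles G v n = card {p. pre_digraph.awalk G v p v \<and> length p = n}"

definition num_backtrack_free_cycles ::
    "('a, 'b) pre_digraph \<Rightarrow> ('b \<Rightarrow> 'b) \<Rightarrow> 'a \<Rightarrow> nat \<Rightarrow> nat" where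
  "num_backtrack_free_cycles G arev v n =
    card {p. pre_digraph.awalk G v p v \<and> length p = n \<and> backtrack_free arev p}"

text \<open>
  In a regular graph of degree \<open>k\<close> both sequences of roots below take values between \<open>0\<close> and
  \<open>k\<close>, so the upper limits are finite and \<^const>\<open>real_of_ereal\<close> loses nothing.
\<close>

definition cycle_growth :: "('a, 'b) pre_digraph \<Rightarrow> 'a \<Rightarrow> real" where
  "cycle_growth G v =
    real_of_ereal (limsup (\<lambda>n. ereal (root n (real (num_cycles G v n)))))"

definition backtrack_free_cycle_growth :: "('a, 'b) pre_digraph \<Rightarrow> ('b \<Rightarrow> 'b) \<Rightarrow> 'a \<Rightarrow> real" where
  "backtrack_free_cycle_growth G arev v =
    real_of_ereal (limsup (\<lambda>n. ereal (root n (real (num_backtrack_free_cycles G arev v n)))))"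

definition simple_graph :: "('a, 'b) pre_digraph \<Rightarrow> bool" where
  "simple_graph G \<longleftrightarrow> loopfree_digraph G \<and> nomulti_digraph G"

definition graph_automorphism ::
    "('a, 'b) pre_digraph \<Rightarrow> ('b \<Rightarrow> 'b) \<Rightarrow> ('a, 'b, 'a, 'b) digraph_isomorphism \<Rightarrow> bool" where
  "graph_automorphism G arev h \<longleftrightarrow>
    pre_digraph.digraph_isomorphism G h \<and> app_iso h G = G \<and>
    (\<forall>a\<in>arcs G. iso_arcs h (arev a) = arev (iso_arcs h a))"

definition vertex_transitive :: "('a, 'b) pre_digraph \<Rightarrow> ('b \<Rightarrow> 'b) \<Rightarrow> bool" where
  "vertex_transitive G arev \<longleftrightarrow>
    (\<forall>u\<in>verts G. \<forall>v\<in>verts G. \<exists>h. graph_automorphism G arev h \<and> iso_verts h u = v)"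

text \<open>
  The library's \<^const>\<open>tree\<close> is not usable here: it forbids directed cycles, and \<open>[a, arev a]\<close>
  is one. The cycles of an undirected graph do not pass the same edge in both directions.
\<close>

definition undirected_tree :: "('a, 'b) pre_digraph \<Rightarrow> ('b \<Rightarrow> 'b) \<Rightarrow> bool" where
  "undirected_tree G arev \<longleftrightarrow>
    Digraph_Component.connected G \<and>
    \<not> (\<exists>p. pre_digraph.cycle G p \<and> (\<forall>a\<in>set p. arev a \<notin> set p))"

end

theory Submission
  imports Defs "HOL-Analysis.Summation_Tests"
begin

text \<open>
  Write q = k - 1. Sorting the walks from u to v by their reduction expresses the number of walks of
  length n as the sum over j of c(n, j) times the number of backtrack-free walks of length j, where
  c(n, j) counts the walks of length n between two given vertices at distance j of the k-regular
  tree. For z = w / (1 + q w^2) with q w^2 < 1, the generating function of c(n, j) at z is a constant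
  multiple of w^j, hence the series of all cycles converges at z if and only if the series of
  backtrack-free cycles converges at w. Comparing the radii of convergence gives the estimate and the
  identity; the lower bound 2 sqrt q for the growth of cycles is the growth of c(n, 0).

  For the vertex-transitive case with k at least 3, suppose that the growth of cycles is at most
  2 sqrt q. Then for every l > 2 sqrt q the Green function is a positive function f whose sum over the
  neighbours of x is at most l f(x). The supremum of the ratios of f at the ends of an arc is close to
  sqrt q as l tends to 2 sqrt q. Close to the supremum, the inequality at the tail of the arc forces
  f to decrease by a factor close to sqrt q > 1 along every other arc there, and this propagates along
  backtrack-free walks of bounded length, which is absurd along a cycle.
\<close>

subsection \<open>Walks in the regular tree\<close>

text \<open>The number of walks of length n in the (q + 1)-regular tree from a vertex at distance j from
  the root to the root.\<close>

fun tree_walks :: "real \<Rightarrow> nat \<Rightarrow> nat \<Rightarrow> real" where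
  "tree_walks q 0 j = (if j = 0 then 1 else 0)"
| "tree_walks q (Suc n) 0 = (q + 1) * tree_walks q n 1"
| "tree_walks q (Suc n) (Suc j) = tree_walks q n j + q * tree_walks q n (Suc (Suc j))"

lemma tree_walks_nonneg: "0 \<le> q \<Longrightarrow> 0 \<le> tree_walks q n j"
  by (induction q n j rule: tree_walks.induct) auto

lemma tree_walks_eq_0: "n < j \<Longrightarrow> tree_walks q n j = 0"
  by (induction q n j rule: tree_walks.induct) auto

lemma tree_walks_diag: "tree_walks q j j = 1"
  by (induction j) (auto simp: tree_walks_eq_0)

lemma tree_walks_sum_0:
  "(\<Sum>n<Suc N. tree_walks q n 0 * z ^ n)
     = 1 + (q + 1) * z * (\<Sum>n<N. tree_walks q n 1 * z ^ n)"
  unfolding sum.lessThan_Suc_shift by (simp add: sum_distrib_left mult_ac)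

lemma tree_walks_sum_Suc:
  "(\<Sum>n<Suc N. tree_walks q n (Suc j) * z ^ n)
     = z * ((\<Sum>n<N. tree_walks q n j * z ^ n) + q * (\<Sum>n<N. tree_walks q n (Suc (Suc j)) * z ^ n))"
  unfolding sum.lessThan_Suc_shift
  by (simp add: sum_distrib_left sum.distrib[symmetric] algebra_simps)

lemma tree_walks_suminf_Suc:
  assumes "\<And>j. summable (\<lambda>n. tree_walks q n j * z ^ n)"
  shows "(\<Sum>n. tree_walks q n (Suc j) * z ^ n)
     = z * ((\<Sum>n. tree_walks q n j * z ^ n) + q * (\<Sum>n. tree_walks q n (Suc (Suc j)) * z ^ n))"
proof -
  have "(\<lambda>N. \<Sum>n<Suc N. tree_walks q n (Suc j) * z ^ n)
      \<longlonglongrightarrow> (\<Sum>n. tree_walks q n (Suc j) * z ^ n)"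
    by (intro LIMSEQ_Suc summable_LIMSEQ assms)
  moreover have "(\<lambda>N. \<Sum>n<Suc N. tree_walks q n (Suc j) * z ^ n)
      \<longlonglongrightarrow> z * ((\<Sum>n. tree_walks q n j * z ^ n) + q * (\<Sum>n. tree_walks q n (Suc (Suc j)) * z ^ n))"
    unfolding tree_walks_sum_Suc by (intro tendsto_intros summable_LIMSEQ assms)
  ultimately show ?thesis by (rule LIMSEQ_unique)
qed

text \<open>\<open>F * w ^ j\<close> solves exactly the system that the generating functions satisfy
  at \<open>z\<close>. The coefficients of the system are nonnegative and the empty sum lies below
  this solution, so induction on \<open>N\<close> keeps all partial sums below it.\<close>

lemma tree_walks_sum_le:
  assumes q: "1 \<le> q" and w: "0 < w" "q * w\<^sup>2 < 1" and z: "z = w / (1 + q * w\<^sup>2)"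
  shows "(\<Sum>n<N. tree_walks q n j * z ^ n) \<le> (1 + q * w\<^sup>2) / (1 - w\<^sup>2) * w ^ j"
proof -
  define F where "F = (1 + q * w\<^sup>2) / (1 - w\<^sup>2)"
  have "1 * w\<^sup>2 \<le> q * w\<^sup>2" using q by (intro mult_right_mono) auto
  then have w1: "w\<^sup>2 < 1" using w by linarith
  have D: "1 + q * w\<^sup>2 > 0" using q by (simp add: add_pos_nonneg)
  have z0: "z > 0" using w D by (simp add: z)
  have F0: "F \<ge> 0" using w1 D by (simp add: F_def)
  have zD: "z * (1 + q * w\<^sup>2) = w" using D by (simp add: z)
  have FD: "F * (1 - w\<^sup>2) = 1 + q * w\<^sup>2" using w1 by (simp add: F_def)
  have "(1 + q * w\<^sup>2) * (1 + (q + 1) * z * (F * w))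
      = F * (1 - w\<^sup>2) + (q + 1) * (z * (1 + q * w\<^sup>2)) * (F * w)"
    unfolding FD by (simp add: algebra_simps)
  also have "\<dots> = (1 + q * w\<^sup>2) * F"
    unfolding zD by (simp add: algebra_simps power2_eq_square)
  finally have F_eq: "1 + (q + 1) * z * (F * w) = F" using D by simp
  have "(\<Sum>n<N. tree_walks q n j * z ^ n) \<le> F * w ^ j"
  proof (induction N arbitrary: j)
    case 0
    then show ?case using F0 w by simp
  next
    case (Suc N)
    show ?case
    proof (cases j)
      case 0
      have "(q + 1) * z * (\<Sum>n<N. tree_walks q n 1 * z ^ n) \<le> (q + 1) * z * (F * w)"
        using Suc.IH[of 1] q z0 by (intro mult_left_mono) auto
      then show ?thesis unfolding 0 tree_walks_sum_0 using F_eq by simp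
    next
      case (Suc i)
      have "(\<Sum>n<Suc N. tree_walks q n (Suc i) * z ^ n)
          \<le> z * (F * w ^ i + q * (F * w ^ Suc (Suc i)))"
        unfolding tree_walks_sum_Suc using Suc.IH[of i] Suc.IH[of "Suc (Suc i)"] q z0
        by (intro mult_left_mono add_mono) auto
      also have "\<dots> = F * w ^ i * (z * (1 + q * w\<^sup>2))"
        by (simp add: algebra_simps power2_eq_square)
      also have "\<dots> = F * w ^ Suc i" unfolding zD by simp
      finally show ?thesis unfolding Suc .
    qed
  qed
  then show ?thesis by (simp add: F_def)
qed

lemma tree_walks_summable:
  assumes "1 \<le> q" "0 < w" "q * w\<^sup>2 < 1" "z = w / (1 + q * w\<^sup>2)"
  shows "summable (\<lambda>n. tree_walks q n j * z ^ n)"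
proof (rule summableI_nonneg_bounded)
  show "0 \<le> tree_walks q n j * z ^ n" for n
    using assms tree_walks_nonneg[of q n j] by (intro mult_nonneg_nonneg) auto
qed (rule tree_walks_sum_le[OF assms])

text \<open>The full series solve the same recurrence. Being dominated by the powers of
  \<open>w\<close>, they equal \<open>S 0 * w ^ j\<close>, and the term \<open>n = 0\<close> alone
  gives \<open>S 0 \<ge> 1\<close>.\<close>

lemma tree_walks_suminf_ge:
  assumes q: "1 \<le> q" and w: "0 < w" "q * w\<^sup>2 < 1" and z: "z = w / (1 + q * w\<^sup>2)"
  shows "w ^ j \<le> (\<Sum>n. tree_walks q n j * z ^ n)"
proof -
  note sm = tree_walks_summable[OF assms]
  define S where "S j = (\<Sum>n. tree_walks q n j * z ^ n)" for j
  define F where "F = (1 + q * w\<^sup>2) / (1 - w\<^sup>2)"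
  have D: "1 + q * w\<^sup>2 > 0" using q by (simp add: add_pos_nonneg)
  have z0: "z > 0" using w D by (simp add: z)
  have zD: "z * (1 + q * w\<^sup>2) = w" using D by (simp add: z)
  have nn: "0 \<le> tree_walks q n j * z ^ n" for n j
    using q z0 tree_walks_nonneg[of q n j] by (intro mult_nonneg_nonneg) auto
  have S0: "S j \<ge> 0" for j unfolding S_def by (intro suminf_nonneg sm nn)
  have SF: "S j \<le> F * w ^ j" for j
    unfolding S_def F_def by (intro suminf_le_const sm tree_walks_sum_le[OF assms])
  have rec: "w * S (Suc (Suc j)) * q = (1 + q * w\<^sup>2) * S (Suc j) - w * S j" for j
  proof -
    have "(1 + q * w\<^sup>2) * S (Suc j) = (z * (1 + q * w\<^sup>2)) * (S j + q * S (Suc (Suc j)))"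
      using tree_walks_suminf_Suc[OF sm, of j] unfolding S_def by (simp add: mult_ac)
    then show ?thesis unfolding zD by (simp add: algebra_simps)
  qed
  \<comment> \<open>The solutions of the recurrence are spanned by the powers of w and of 1 / (q w), which is
    greater than w; the bound by a multiple of the powers of w excludes the second kind.\<close>
  define E where "E j = S (Suc j) - w * S j" for j
  have E_Suc: "q * w * E (Suc j) = E j" for j
    using rec[of j] by (simp add: E_def algebra_simps power2_eq_square)
  have E_pow: "(q * w) ^ j * E j = E 0" for j
  proof (induction j)
    case (Suc j)
    have "(q * w) ^ Suc j * E (Suc j) = (q * w) ^ j * (q * w * E (Suc j))" by simp
    then show ?case using E_Suc Suc by simp
  qed simp
  have E_le: "\<bar>E j\<bar> \<le> 2 * F * w * w ^ j" for j
  proof -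
    have "w * S j \<le> w * (F * w ^ j)" using SF w by (intro mult_left_mono) auto
    moreover have "0 \<le> w * S j" using S0 w by simp
    ultimately show ?thesis using SF[of "Suc j"] S0[of "Suc j"] by (simp add: E_def algebra_simps)
  qed
  have "\<bar>E 0\<bar> \<le> 2 * F * w * (q * w\<^sup>2) ^ j" for j
  proof -
    have "\<bar>E 0\<bar> = (q * w) ^ j * \<bar>E j\<bar>"
      using q w by (subst E_pow[symmetric, of j]) (simp add: abs_mult)
    also have "\<dots> \<le> (q * w) ^ j * (2 * F * w * w ^ j)"
      using E_le q w by (intro mult_left_mono) auto
    finally show ?thesis by (simp add: power_mult_distrib power2_eq_square mult_ac)
  qed
  moreover have "(\<lambda>j. 2 * F * w * (q * w\<^sup>2) ^ j) \<longlonglongrightarrow> 2 * F * w * 0"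
    using q w by (intro tendsto_intros LIMSEQ_power_zero) auto
  ultimately have "\<bar>E 0\<bar> \<le> 0"
    by (intro LIMSEQ_le_const[of "\<lambda>j. 2 * F * w * (q * w\<^sup>2) ^ j" 0]) auto
  then have E0: "E j = 0" for j using E_pow[of j] q w by simp
  have "S 0 \<ge> (\<Sum>n<1. tree_walks q n 0 * z ^ n)"
    unfolding S_def by (intro sum_le_suminf sm) (use nn in auto)
  then have "S 0 \<ge> 1" by simp
  moreover have "S j = S 0 * w ^ j"
  proof (induction j)
    case (Suc j)
    then show ?case using E0[of j] by (simp add: E_def)
  qed simp
  ultimately have "S j \<ge> w ^ j" using w by (simp add: mult_le_cancel_right)
  then show ?thesis by (simp add: S_def)
qed

text \<open>Every vertex of the tree has a neighbour one step farther from the root, so a walk from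
  distance \<open>j + 1\<close> extends to one from distance \<open>j\<close>. For real
  \<open>q\<close> this says that the outward coefficients \<open>q + 1\<close> and \<open>q\<close>
  are at least 1.\<close>

lemma tree_walks_shift:
  assumes "1 \<le> q" shows "tree_walks q n j \<le> tree_walks q (n + j) 0"
proof (induction j arbitrary: n)
  case (Suc j)
  have "tree_walks q n (Suc j) \<le> tree_walks q (Suc n) j"
  proof (cases j)
    case 0
    then show ?thesis using assms tree_walks_nonneg[of q n 1] by (simp add: algebra_simps)
  next
    case (Suc i)
    then show ?thesis using assms tree_walks_nonneg[of q n i] tree_walks_nonneg[of q n "Suc j"]
      by (simp add: add_increasing mult_le_cancel_right1)
  qed
  also have "\<dots> \<le> tree_walks q (Suc n + j) 0" by (rule Suc.IH)
  finally show ?case by simp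
qed simp

text \<open>For such \<open>z\<close> the characteristic equation
  \<open>x = z * (1 + q * x^2)\<close> of the recurrence has no real root, which rules out a
  positive solution: the consecutive ratios would fall by at least \<open>d\<close> at each step and
  become negative.\<close>

lemma tree_walks_0_not_summable:
  assumes q: "1 \<le> q" and z: "1 < 2 * sqrt q * z"
  shows "\<not> summable (\<lambda>n. tree_walks q n 0 * z ^ n)"
proof
  assume sm0: "summable (\<lambda>n. tree_walks q n 0 * z ^ n)"
  have sq: "sqrt q > 0" using q by simp
  have z0: "z > 0" using z sq by (smt (verit) mult_nonneg_nonpos)
  have nn: "0 \<le> tree_walks q n j * z ^ n" for n j
    using q z0 tree_walks_nonneg[of q n j] by (intro mult_nonneg_nonneg) auto
  have sm: "summable (\<lambda>n. tree_walks q n j * z ^ n)" for j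
  proof -
    have "summable (\<lambda>n. inverse (z ^ j) * (tree_walks q (n + j) 0 * z ^ (n + j)))"
      by (intro summable_mult summable_ignore_initial_segment sm0)
    then have "summable (\<lambda>n. tree_walks q (n + j) 0 * z ^ n)"
      using z0 by (simp add: power_add field_simps)
    then show ?thesis
    proof (rule summable_comparison_test'[where N = 0])
      fix n :: nat
      have "tree_walks q n j * z ^ n \<le> tree_walks q (n + j) 0 * z ^ n"
        using tree_walks_shift[OF q] z0 by (intro mult_right_mono) auto
      then show "norm (tree_walks q n j * z ^ n) \<le> tree_walks q (n + j) 0 * z ^ n"
        using nn[of n j] by (simp del: tree_walks.simps)
    qed
  qed
  define S where "S j = (\<Sum>n. tree_walks q n j * z ^ n)" for j
  have Spos: "S j > 0" for j
    unfolding S_def using sm nn z0 tree_walks_diag[of q j]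
    by (intro suminf_pos2[where i = j]) auto
  have rec: "S (Suc j) = z * (S j + q * S (Suc (Suc j)))" for j
    using tree_walks_suminf_Suc[OF sm, of j] unfolding S_def .
  define r where "r j = S (Suc j) / S j" for j
  have rpos: "r j > 0" for j using Spos by (simp add: r_def)
  define d where "d = (2 * sqrt q * z - 1) / (q * z)"
  have dpos: "d > 0" using q z z0 by (simp add: d_def)
  \<comment> \<open>By the recurrence, q z r' = 1 - z / r for consecutive ratios r and r', while
    z / r + q z r is at least 2 sqrt q z by AM-GM.\<close>
  have step: "r (Suc j) \<le> r j - d" for j
  proof -
    have "z * (1 / r j + q * r (Suc j)) = z * (S j + q * S (Suc (Suc j))) / S (Suc j)"
      using Spos[of j] Spos[of "Suc j"] Spos[of "Suc (Suc j)"] by (simp add: r_def field_simps)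
    also have "\<dots> = 1" unfolding rec[symmetric] using Spos[of "Suc j"] by simp
    finally have "1 = z * (1 / r j + q * r (Suc j))" ..
    then have 1: "q * z * r (Suc j) = 1 - z / r j" by (simp add: algebra_simps)
    have "0 \<le> (1 - sqrt q * r j)\<^sup>2 / r j" using rpos[of j] by simp
    also have "(1 - sqrt q * r j)\<^sup>2 / r j = 1 / r j + q * r j - 2 * sqrt q"
      using rpos[of j] q by (simp add: field_simps power2_eq_square)
    finally have "z * (2 * sqrt q) \<le> z * (1 / r j + q * r j)" using z0 by (intro mult_left_mono) auto
    then have "q * z * r (Suc j) \<le> q * z * r j - (2 * sqrt q * z - 1)"
      unfolding 1 by (simp add: algebra_simps)
    also have "2 * sqrt q * z - 1 = q * z * d" using q z0 by (simp add: d_def)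
    also have "q * z * r j - q * z * d = q * z * (r j - d)" by (simp add: algebra_simps)
    finally show ?thesis using q z0 by simp
  qed
  have "r j \<le> r 0 - real j * d" for j
  proof (induction j)
    case (Suc j)
    then show ?case using step[of j] by (simp add: algebra_simps)
  qed simp
  moreover obtain j where "r 0 < real j * d" using reals_Archimedean3[OF dpos] by blast
  ultimately show False using rpos[of j] by (smt (verit))
qed

section \<open>Comparison of a power series with its tree transform\<close>

text \<open>After exchanging the sums, \<open>b j\<close> is multiplied by the series of
  \<open>tree_walks q n j * z ^ n\<close>, which lies between \<open>w ^ j\<close> and a constant
  multiple of it. Nonnegativity allows the exchange on partial sums.\<close>

lemma tree_transform_summable_iff:
  fixes b C :: "nat \<Rightarrow> real"
  assumes q: "1 \<le> q" and w: "0 < w" "q * w\<^sup>2 < 1" and z: "z = w / (1 + q * w\<^sup>2)"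
    and b: "\<And>j. 0 \<le> b j" and C: "\<And>n. C n = (\<Sum>j\<le>n. tree_walks q n j * b j)"
  shows "summable (\<lambda>j. b j * w ^ j) \<longleftrightarrow> summable (\<lambda>n. C n * z ^ n)"
proof
  have z0: "z > 0" using w q by (simp add: z add_pos_nonneg)
  have c0: "0 \<le> tree_walks q n j" for n j using q by (intro tree_walks_nonneg) simp
  have C0: "0 \<le> C n" for n unfolding C using c0 b by (intro sum_nonneg mult_nonneg_nonneg) auto
  \<comment> \<open>Any cutoff \<open>J\<close> is allowed, even beyond \<open>n\<close>, since
    \<open>tree_walks q n j\<close> vanishes for \<open>j > n\<close>.\<close>
  have C_le: "(\<Sum>j<J. tree_walks q n j * b j) \<le> C n" for n J
  proof -
    have "(\<Sum>j<J. tree_walks q n j * b j) = (\<Sum>j\<in>{..<J} \<inter> {..n}. tree_walks q n j * b j)"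
      by (intro sum.mono_neutral_right) (auto simp: tree_walks_eq_0 not_le)
    also have "\<dots> \<le> C n" unfolding C using c0 b by (intro sum_mono2) auto
    finally show ?thesis .
  qed
  {
    assume sm: "summable (\<lambda>j. b j * w ^ j)"
    define F where "F = (1 + q * w\<^sup>2) / (1 - w\<^sup>2)"
    have "1 * w\<^sup>2 \<le> q * w\<^sup>2" using q by (intro mult_right_mono) auto
    then have "w\<^sup>2 < 1" using w by linarith
    then have F0: "0 \<le> F" using q by (simp add: F_def)
    show "summable (\<lambda>n. C n * z ^ n)"
    proof (rule summableI_nonneg_bounded)
      show "0 \<le> C n * z ^ n" for n using C0 z0 by simp
      fix N
      have "(\<Sum>n<N. C n * z ^ n) = (\<Sum>n<N. \<Sum>j<N. b j * (tree_walks q n j * z ^ n))"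
      proof (intro sum.cong refl)
        fix n assume n: "n \<in> {..<N}"
        have "C n = (\<Sum>j<N. tree_walks q n j * b j)"
          unfolding C using n by (intro sum.mono_neutral_left) (auto simp: tree_walks_eq_0)
        then show "C n * z ^ n = (\<Sum>j<N. b j * (tree_walks q n j * z ^ n))"
          by (simp add: sum_distrib_left mult_ac)
      qed
      also have "\<dots> = (\<Sum>j<N. b j * (\<Sum>n<N. tree_walks q n j * z ^ n))"
        by (subst sum.swap) (simp add: sum_distrib_left)
      also have "\<dots> \<le> (\<Sum>j<N. b j * (F * w ^ j))"
        unfolding F_def by (intro sum_mono mult_left_mono tree_walks_sum_le[OF q w z] b)
      also have "\<dots> = F * (\<Sum>j<N. b j * w ^ j)" by (simp add: sum_distrib_left mult_ac)
      also have "\<dots> \<le> F * (\<Sum>j. b j * w ^ j)"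
        using b w by (intro mult_left_mono sum_le_suminf sm F0) auto
      finally show "(\<Sum>n<N. C n * z ^ n) \<le> F * (\<Sum>j. b j * w ^ j)" .
    qed
  }
  {
    assume sm: "summable (\<lambda>n. C n * z ^ n)"
    note sc = tree_walks_summable[OF q w z]
    show "summable (\<lambda>j. b j * w ^ j)"
    proof (rule summableI_nonneg_bounded)
      show "0 \<le> b j * w ^ j" for j using b w by simp
      fix J
      have "(\<Sum>j<J. b j * w ^ j) \<le> (\<Sum>j<J. b j * (\<Sum>n. tree_walks q n j * z ^ n))"
        by (intro sum_mono mult_left_mono tree_walks_suminf_ge[OF q w z] b)
      also have "\<dots> = (\<Sum>j<J. \<Sum>n. b j * (tree_walks q n j * z ^ n))"
        using sc by (simp add: suminf_mult)
      also have "\<dots> = (\<Sum>n. \<Sum>j<J. b j * (tree_walks q n j * z ^ n))"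
        by (intro suminf_sum[symmetric] summable_mult sc)
      also have "\<dots> \<le> (\<Sum>n. C n * z ^ n)"
      proof (intro suminf_le sm summable_sum summable_mult sc)
        fix n
        have "(\<Sum>j<J. b j * (tree_walks q n j * z ^ n)) = (\<Sum>j<J. tree_walks q n j * b j) * z ^ n"
          by (simp add: sum_distrib_left mult_ac)
        also have "\<dots> \<le> C n * z ^ n" using C_le z0 by (intro mult_right_mono) auto
        finally show "(\<Sum>j<J. b j * (tree_walks q n j * z ^ n)) \<le> C n * z ^ n" .
      qed
      finally show "(\<Sum>j<J. b j * w ^ j) \<le> (\<Sum>n. C n * z ^ n)" .
    qed
  }
qed

subsection \<open>Growth rates\<close>

lemma limsup_root_bounded:
  fixes a :: "nat \<Rightarrow> real"
  assumes a: "\<And>n. 0 \<le> a n" "\<And>n. a n \<le> K ^ n" and K: "0 \<le> K"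
  defines "L \<equiv> limsup (\<lambda>n. ereal (root n (a n)))"
  shows "0 \<le> real_of_ereal L" "real_of_ereal L \<le> K" "ereal (real_of_ereal L) = L"
proof -
  \<comment> \<open>\<open>root 0\<close> is constantly 0, so the index 0 is a case of its
    own.\<close>
  have 1: "0 \<le> root n (a n)" for n using a(1) by (cases "n = 0") auto
  have 2: "root n (a n) \<le> K" for n
  proof (cases "n = 0")
    case False
    then have "root n (a n) \<le> root n (K ^ n)" using a by simp
    then show ?thesis using False K by (simp add: real_root_power_cancel)
  qed (use K in simp)
  have "L \<le> ereal K" unfolding L_def using 2 by (intro Limsup_bounded) auto
  moreover have "0 \<le> L"
    unfolding L_def using 1 by (intro le_Limsup) auto
  ultimately show "0 \<le> real_of_ereal L" "real_of_ereal L \<le> K" "ereal (real_of_ereal L) = L"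
    by (cases L; simp)+
qed

text \<open>This is the Cauchy-Hadamard formula. It leaves \<open>z * l = 1\<close> undecided, so
  the comparisons of growth rates below always choose a \<open>t\<close> strictly in
  between.\<close>

lemma summable_limsup_root:
  fixes a :: "nat \<Rightarrow> real"
  assumes a: "\<And>n. 0 \<le> a n" "\<And>n. a n \<le> K ^ n" and K: "0 \<le> K" and z: "0 < z"
  defines "l \<equiv> real_of_ereal (limsup (\<lambda>n. ereal (root n (a n))))"
  shows "z * l < 1 \<Longrightarrow> summable (\<lambda>n. a n * z ^ n)"
    and "1 < z * l \<Longrightarrow> \<not> summable (\<lambda>n. a n * z ^ n)"
proof -
  have l: "0 \<le> l" "ereal l = limsup (\<lambda>n. ereal (root n (a n)))"
    unfolding l_def using limsup_root_bounded[OF a K] by auto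
  have R: "conv_radius a = inverse (ereal l)"
    using a(1) by (simp add: conv_radius_def l(2))
  show "summable (\<lambda>n. a n * z ^ n)" if "z * l < 1"
  proof (rule summable_in_conv_radius)
    show "ereal (norm z) < conv_radius a"
      unfolding R using that z l(1) by (cases "l = 0") (auto simp: field_simps)
  qed
  show "\<not> summable (\<lambda>n. a n * z ^ n)" if "1 < z * l"
  proof (rule not_summable_outside_conv_radius)
    have "l \<noteq> 0" using that by auto
    then show "conv_radius a < ereal (norm z)"
      unfolding R using that z l(1) by (auto simp: field_simps)
  qed
qed

text \<open>With \<open>w = 1 / t\<close>, growth \<open>t\<close> of the backtrack-free walks
  corresponds to growth \<open>t + q / t\<close> of all walks.\<close>

lemma inverse_tree_substitution:
  fixes q t :: real
  assumes "0 < t" "0 \<le> q"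
  shows "(1 / t) / (1 + q * (1 / t)\<^sup>2) = 1 / (t + q / t)"
  using assms by (simp add: field_simps power2_eq_square add_pos_nonneg)

text \<open>The difference of the two sides is \<open>(t - s) * (s * t - q) / (s * t)\<close>; from
  \<open>sqrt q\<close> on, \<open>t + q / t\<close> is on its increasing branch.\<close>

lemma add_divide_strict_mono:
  fixes q s t :: real
  assumes s: "sqrt q \<le> s" "s < t" and q: "0 < q"
  shows "s + q / s < t + q / t"
proof -
  have s0: "0 < s" using s q by (smt (verit) real_sqrt_gt_zero)
  have "q = sqrt q * sqrt q" using q by simp
  also have "\<dots> \<le> s * s" using s q s0 by (intro mult_mono) auto
  also have "\<dots> < s * t" using s s0 by simp
  finally have "q < s * t" .
  then have "0 < (t - s) * (s * t - q) / (s * t)"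
    using s s0 by (intro divide_pos_pos mult_pos_pos) auto
  also have "(t - s) * (s * t - q) / (s * t) = (t + q / t) - (s + q / s)"
    using s s0 by (simp add: field_simps)
  finally show ?thesis by simp
qed

text \<open>The series can be compared at \<open>1 / t\<close> only for \<open>t > sqrt q\<close>.
  The upper estimate uses \<open>t\<close> above \<open>\<alpha> \<ge> sqrt q\<close>. The reverse
  one uses \<open>t\<close> between \<open>sqrt q\<close> and \<open>\<alpha>\<close>, and
  \<open>2 * sqrt q < \<rho>\<close> guarantees that this interval is nonempty.\<close>

lemma tree_transform_growth:
  fixes b C :: "nat \<Rightarrow> real"
  assumes q: "1 \<le> q"
    and b: "\<And>n. 0 \<le> b n" "\<And>n. b n \<le> K ^ n" and C: "\<And>n. 0 \<le> C n" "\<And>n. C n \<le> K ^ n" and K: "0 \<le> K"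
    and b_0: "b 0 = 1" and trans: "\<And>n. C n = (\<Sum>j\<le>n. tree_walks q n j * b j)"
  defines "\<rho> \<equiv> real_of_ereal (limsup (\<lambda>n. ereal (root n (C n))))"
    and "\<gamma> \<equiv> real_of_ereal (limsup (\<lambda>n. ereal (root n (b n))))"
  shows "2 * sqrt q \<le> \<rho>" (is ?lower)
    and "\<gamma> \<le> (\<rho> + sqrt (\<rho>\<^sup>2 - 4 * q)) / 2" (is ?upper)
    and "2 * sqrt q < \<rho> \<Longrightarrow> \<gamma> = (\<rho> + sqrt (\<rho>\<^sup>2 - 4 * q)) / 2" (is "_ \<Longrightarrow> ?eq")
proof -
  note sumC = summable_limsup_root[OF C K, folded \<rho>_def]
  note sumb = summable_limsup_root[OF b K, folded \<gamma>_def]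
  have \<rho>0: "0 \<le> \<rho>" unfolding \<rho>_def by (rule limsup_root_bounded[OF C K])
  have \<gamma>0: "0 \<le> \<gamma>" unfolding \<gamma>_def by (rule limsup_root_bounded[OF b K])
  have sq: "0 < sqrt q" using q by simp
  show low: ?lower
  proof (rule ccontr)
    assume "\<not> ?lower"
    then obtain t where t: "\<rho> < t" "t < 2 * sqrt q" using dense[of \<rho> "2 * sqrt q"] by auto
    have "summable (\<lambda>n. C n * (1 / t) ^ n)" using t \<rho>0 by (intro sumC) auto
    then have "summable (\<lambda>n. tree_walks q n 0 * (1 / t) ^ n)"
    proof (rule summable_comparison_test'[where N = 0])
      fix n :: nat
      have c0: "0 \<le> tree_walks q n j" for j using q by (intro tree_walks_nonneg) simp
      \<comment> \<open>The term \<open>j = 0\<close> alone shows that there are at least as many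
        cycles as in the tree.\<close>
      have "(\<Sum>j\<in>{0}. tree_walks q n j * b j) \<le> C n"
        unfolding trans using c0 b by (intro sum_mono2) auto
      then have "tree_walks q n 0 \<le> C n" using b_0 by simp
      then show "norm (tree_walks q n 0 * (1 / t) ^ n) \<le> C n * (1 / t) ^ n"
        using c0[of 0] t \<rho>0 by (auto simp: abs_mult intro!: mult_right_mono)
    qed
    moreover have "1 < 2 * sqrt q * (1 / t)" using t \<rho>0 by simp
    ultimately show False using tree_walks_0_not_summable[OF q] by blast
  qed
  \<comment> \<open>\<open>\<alpha>\<close> is the larger root of \<open>x + q / x = \<rho>\<close>;
    the roots have product \<open>q\<close>, so it is at least \<open>sqrt q\<close>.\<close>
  define \<alpha> where "\<alpha> = (\<rho> + sqrt (\<rho>\<^sup>2 - 4 * q)) / 2"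
  have "(2 * sqrt q)\<^sup>2 \<le> \<rho>\<^sup>2" using low sq by (intro power_mono) auto
  then have disc: "0 \<le> \<rho>\<^sup>2 - 4 * q" using q by (simp add: power_mult_distrib)
  have \<alpha>: "sqrt q \<le> \<alpha>" using low disc by (simp add: \<alpha>_def field_simps add_increasing2)
  have \<alpha>pos: "0 < \<alpha>" using \<alpha> sq by linarith
  have "\<alpha> * \<alpha> + q = \<rho> * \<alpha>"
    using disc by (simp add: \<alpha>_def field_simps power2_eq_square)
  then have \<alpha>\<rho>: "\<alpha> + q / \<alpha> = \<rho>" using \<alpha>pos by (simp add: field_simps)
  have iff: "summable (\<lambda>j. b j * (1 / t) ^ j) \<longleftrightarrow> summable (\<lambda>n. C n * (1 / (t + q / t)) ^ n)"
    if t: "sqrt q < t" for t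
  proof (rule tree_transform_summable_iff[OF q _ _ _ b(1) trans])
    have t0: "0 < t" using t sq by linarith
    then show "0 < 1 / t" by simp
    have "(sqrt q)\<^sup>2 < t\<^sup>2" using t sq by (intro power_strict_mono) auto
    then show "q * (1 / t)\<^sup>2 < 1" using q t0 by (simp add: field_simps)
    show "1 / (t + q / t) = 1 / t / (1 + q * (1 / t)\<^sup>2)"
      using inverse_tree_substitution[OF t0] q by simp
  qed
  show upper: ?upper
  proof (rule ccontr)
    assume "\<not> ?upper"
    then obtain t where t: "\<alpha> < t" "t < \<gamma>" using dense[of \<alpha> \<gamma>] by (auto simp: \<alpha>_def)
    then have t0: "0 < t" using \<alpha>pos by linarith
    have "\<rho> < t + q / t" using add_divide_strict_mono[OF \<alpha> t(1)] q \<alpha>\<rho> by simp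
    then have "summable (\<lambda>n. C n * (1 / (t + q / t)) ^ n)" using \<rho>0 by (intro sumC) auto
    then have "summable (\<lambda>j. b j * (1 / t) ^ j)" using iff[of t] t \<alpha> by auto
    moreover have "\<not> summable (\<lambda>j. b j * (1 / t) ^ j)" using t t0 by (intro sumb) auto
    ultimately show False by blast
  qed
  show ?eq if "2 * sqrt q < \<rho>"
  proof (rule ccontr)
    assume "\<not> ?eq"
    then have "\<gamma> < \<alpha>" using upper by (auto simp: \<alpha>_def)
    moreover have "sqrt q < \<alpha>"
    proof -
      have "2 * sqrt q + 0 < \<rho> + sqrt (\<rho>\<^sup>2 - 4 * q)"
        using that disc by (intro add_less_le_mono) auto
      then show ?thesis by (simp add: \<alpha>_def)
    qed
    ultimately obtain t where t: "max \<gamma> (sqrt q) < t" "t < \<alpha>"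
      using dense[of "max \<gamma> (sqrt q)" \<alpha>] by auto
    then have t0: "0 < t" using \<gamma>0 by linarith
    have "t + q / t < \<rho>" using add_divide_strict_mono[of q t \<alpha>] t q \<alpha>\<rho> by simp
    moreover have "0 < t + q / t" using t0 q by (simp add: add_pos_nonneg)
    ultimately have "\<not> summable (\<lambda>n. C n * (1 / (t + q / t)) ^ n)" by (intro sumC) auto
    then have "\<not> summable (\<lambda>j. b j * (1 / t) ^ j)" using iff[of t] t by auto
    moreover have "summable (\<lambda>j. b j * (1 / t) ^ j)" using t t0 by (intro sumb) auto
    ultimately show False by blast
  qed
qed

subsection \<open>Counting walks in a regular graph\<close>

text \<open>In the application \<open>X j\<close> is the sum of \<open>b j\<close> over the
  neighbours. Its recurrence is the transpose of that of \<open>tree_walks\<close>, so shifting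
  indices moves the recurrence from one factor to the other.\<close>

lemma tree_walks_sum_recurrence:
  fixes b X :: "nat \<Rightarrow> real"
  assumes X0: "X 0 = b 1"
    and XS: "\<And>j. X (Suc j) = b (Suc (Suc j)) + (if j = 0 then q + 1 else q) * b j"
  shows "(\<Sum>j\<le>n. tree_walks q n j * X j) = (\<Sum>j\<le>Suc n. tree_walks q (Suc n) j * b j)"
proof -
  let ?c = "tree_walks q n"
  \<comment> \<open>The added terms are zero; the longer range leaves room for shifting the index
    twice.\<close>
  have ext: "(\<Sum>j\<le>n. ?c j * Y j) = (\<Sum>j\<le>Suc (Suc n). ?c j * Y j)" for Y
    by (simp add: tree_walks_eq_0)
  have "(\<Sum>j\<le>n. ?c j * X j) = ?c 0 * b 1 + (\<Sum>j\<le>Suc n. ?c (Suc j) * b (Suc (Suc j)))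
      + (\<Sum>j\<le>Suc n. ?c (Suc j) * ((if j = 0 then q + 1 else q) * b j))"
    unfolding ext sum.atMost_Suc_shift[of _ "Suc n"] X0 XS by (simp add: distrib_left sum.distrib)
  also have "?c 0 * b 1 + (\<Sum>j\<le>Suc n. ?c (Suc j) * b (Suc (Suc j))) = (\<Sum>j\<le>n. ?c j * b (Suc j))"
    unfolding ext sum.atMost_Suc_shift[of _ "Suc n"] by simp
  also have "(\<Sum>j\<le>Suc n. ?c (Suc j) * ((if j = 0 then q + 1 else q) * b j))
      = (q + 1) * ?c 1 * b 0 + (\<Sum>j\<le>n. q * ?c (Suc (Suc j)) * b (Suc j))"
    unfolding sum.atMost_Suc_shift[of _ n] by (simp add: mult_ac)
  finally show ?thesis
    unfolding sum.atMost_Suc_shift[of _ n] by (simp add: distrib_right sum.distrib)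
qed

lemma backtrack_free_Nil [simp]: "backtrack_free arev []"
  by (simp add: backtrack_free_def)

lemma backtrack_free_Cons:
  "backtrack_free arev (a # p) \<longleftrightarrow> (p = [] \<or> hd p \<noteq> arev a) \<and> backtrack_free arev p"
proof
  assume *: "backtrack_free arev (a # p)"
  then have "p ! i \<noteq> arev ((a # p) ! i)" if "i < length p" for i
    using that by (auto simp: backtrack_free_def)
  from this[of 0] this[of "Suc _"] show "(p = [] \<or> hd p \<noteq> arev a) \<and> backtrack_free arev p"
    by (auto simp: backtrack_free_def hd_conv_nth)
next
  assume "(p = [] \<or> hd p \<noteq> arev a) \<and> backtrack_free arev p"
  then show "backtrack_free arev (a # p)"
    by (auto simp: backtrack_free_def hd_conv_nth nth_Cons split: nat.splits)
qed

lemma backtrack_freeI_set: "(\<And>a. a \<in> set p \<Longrightarrow> arev a \<notin> set p) \<Longrightarrow> backtrack_free arev p"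
  by (auto simp: backtrack_free_def) (metis Suc_lessD nth_mem)

locale regular_bidirected_digraph = bidirected_digraph G arev
  for G :: "('a, 'b) pre_digraph" and arev +
  fixes k :: nat
  assumes finite_out_arcs: "u \<in> verts G \<Longrightarrow> finite (out_arcs G u)"
    and card_out_arcs: "u \<in> verts G \<Longrightarrow> card (out_arcs G u) = k"
begin

text \<open>The two endpoints are kept apart because splitting off the first arc moves the first
  one; the cycles are the case \<open>u = v\<close>.\<close>

definition walks :: "'a \<Rightarrow> 'a \<Rightarrow> nat \<Rightarrow> 'b awalk set" where
  "walks u v n = {p. awalk u p v \<and> length p = n}"

definition bf_walks :: "'a \<Rightarrow> 'a \<Rightarrow> nat \<Rightarrow> 'b awalk set" where
  "bf_walks u v n = {p. awalk u p v \<and> length p = n \<and> backtrack_free arev p}"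

lemma walks_Suc: "walks u v (Suc n) = (\<Union>a\<in>out_arcs G u. (#) a ` walks (head G a) v n)"
  by (auto simp: walks_def length_Suc_conv awalk_Cons_iff)

lemma walks_0: "walks u v 0 = (if u = v \<and> u \<in> verts G then {[]} else {})"
  by (auto simp: walks_def awalk_Nil_iff)

lemma head_out_arcs: "a \<in> out_arcs G u \<Longrightarrow> head G a \<in> verts G"
  by auto

lemma finite_walks: "u \<in> verts G \<Longrightarrow> finite (walks u v n)"
  by (induction n arbitrary: u) (auto simp: walks_0 walks_Suc finite_out_arcs)

lemma card_walks_Suc:
  assumes "u \<in> verts G"
  shows "card (walks u v (Suc n)) = (\<Sum>a\<in>out_arcs G u. card (walks (head G a) v n))"
proof -
  have "card (walks u v (Suc n)) = (\<Sum>a\<in>out_arcs G u. card ((#) a ` walks (head G a) v n))"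
    unfolding walks_Suc using assms
    by (intro card_UN_disjoint) (auto simp: finite_out_arcs finite_walks)
  then show ?thesis by (simp add: card_image)
qed

lemma card_walks_le: "u \<in> verts G \<Longrightarrow> card (walks u v n) \<le> k ^ n"
proof (induction n arbitrary: u)
  case 0
  then show ?case by (simp add: walks_0)
next
  case (Suc n)
  have "card (walks u v (Suc n)) \<le> (\<Sum>a\<in>out_arcs G u. k ^ n)"
    unfolding card_walks_Suc[OF Suc.prems] by (intro sum_mono Suc.IH head_out_arcs)
  then show ?case by (simp add: card_out_arcs[OF Suc.prems])
qed

lemma bf_walks_subset: "bf_walks u v n \<subseteq> walks u v n"
  by (auto simp: bf_walks_def walks_def)

lemma finite_bf_walks: "u \<in> verts G \<Longrightarrow> finite (bf_walks u v n)"
  using finite_subset[OF bf_walks_subset] finite_walks by blast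

lemma card_bf_walks_le: "u \<in> verts G \<Longrightarrow> card (bf_walks u v n) \<le> k ^ n"
  using card_mono[OF finite_walks bf_walks_subset] card_walks_le le_trans by blast

lemma sum_card_bf_walks_0:
  assumes "u \<in> verts G"
  shows "(\<Sum>a\<in>out_arcs G u. card (bf_walks (head G a) v 0)) = card (bf_walks u v 1)"
proof -
  have eq: "bf_walks u v n = walks u v n" if "n \<le> 1" for u n
    using that by (auto simp: bf_walks_def walks_def backtrack_free_def)
  show ?thesis using card_walks_Suc[OF assms, of v 0] by (simp add: eq)
qed

text \<open>Put an arc \<open>a\<close> before a backtrack-free walk from its head. Either no
  backtrack arises (\<open>P1\<close>), or the walk begins with \<open>arev a\<close> and cancelling
  leaves a backtrack-free walk \<open>p\<close> of length \<open>n\<close> from \<open>u\<close>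
  (\<open>P2\<close>). Given \<open>p\<close>, there are \<open>k\<close> choices of
  \<open>a\<close> if \<open>p\<close> is empty and \<open>k - 1\<close> otherwise.\<close>

lemma sum_card_bf_walks_Suc:
  assumes u: "u \<in> verts G"
  shows "(\<Sum>a\<in>out_arcs G u. card (bf_walks (head G a) v (Suc n)))
    = card (bf_walks u v (Suc (Suc n))) + (if n = 0 then k else k - 1) * card (bf_walks u v n)"
proof -
  define P where "P = (SIGMA a:out_arcs G u. bf_walks (head G a) v (Suc n))"
  define P1 where "P1 = {(a, p) \<in> P. hd p \<noteq> arev a}"
  define P2 where "P2 = {(a, p) \<in> P. hd p = arev a}"
  \<comment> \<open>Before cancelling, \<open>arev a\<close> stands in front of \<open>p\<close>, so
    the first arc of \<open>p\<close> must differ from \<open>arev (arev a) = a\<close>.\<close>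
  define Q where "Q = (SIGMA p:bf_walks u v n. {a \<in> out_arcs G u. p = [] \<or> hd p \<noteq> a})"
  have fin: "finite P"
    unfolding P_def using u by (intro finite_SigmaI finite_out_arcs finite_bf_walks head_out_arcs)
  have "(\<Sum>a\<in>out_arcs G u. card (bf_walks (head G a) v (Suc n))) = card P"
    unfolding P_def using u by (intro card_SigmaI[symmetric] finite_out_arcs) (auto intro: finite_bf_walks)
  also have "\<dots> = card P1 + card P2"
  proof -
    have "P = P1 \<union> P2" "P1 \<inter> P2 = {}" by (auto simp: P1_def P2_def)
    then show ?thesis using fin by (simp add: card_Un_disjoint)
  qed
  also have "card P1 = card (bf_walks u v (Suc (Suc n)))"
  proof (rule bij_betw_same_card)
    show "bij_betw (\<lambda>(a, p). a # p) P1 (bf_walks u v (Suc (Suc n)))"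
      unfolding bij_betw_def
    proof
      show "inj_on (\<lambda>(a, p). a # p) P1" by (auto simp: inj_on_def)
      show "(\<lambda>(a, p). a # p) ` P1 = bf_walks u v (Suc (Suc n))"
      proof (intro equalityI subsetI)
        fix p assume "p \<in> bf_walks u v (Suc (Suc n))"
        then obtain a r where "p = a # r" "(a, r) \<in> P1"
          by (cases p) (auto simp: P1_def P_def bf_walks_def awalk_Cons_iff backtrack_free_Cons)
        then show "p \<in> (\<lambda>(a, p). a # p) ` P1" by force
      qed (auto simp: P1_def P_def bf_walks_def awalk_Cons_iff backtrack_free_Cons)
    qed
  qed
  also have "card P2 = card Q"
  proof (rule bij_betw_same_card[symmetric])
    show "bij_betw (\<lambda>(p, a). (a, arev a # p)) Q P2"
      unfolding bij_betw_def
    proof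
      show "inj_on (\<lambda>(p, a). (a, arev a # p)) Q" by (auto simp: inj_on_def)
      show "(\<lambda>(p, a). (a, arev a # p)) ` Q = P2"
      proof (intro equalityI subsetI)
        fix x assume "x \<in> P2"
        then obtain a p where "x = (a, arev a # p)" "(p, a) \<in> Q"
          by (auto simp: P2_def P_def Q_def bf_walks_def awalk_Cons_iff backtrack_free_Cons
              length_Suc_conv)
        then show "x \<in> (\<lambda>(p, a). (a, arev a # p)) ` Q" by force
      qed (auto simp: P2_def P_def Q_def bf_walks_def awalk_Cons_iff backtrack_free_Cons)
    qed
  qed
  also have "card Q = (\<Sum>p\<in>bf_walks u v n. card {a \<in> out_arcs G u. p = [] \<or> hd p \<noteq> a})"
    unfolding Q_def using u
    by (intro card_SigmaI finite_bf_walks ballI finite_subset[OF _ finite_out_arcs[OF u]]) auto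
  also have "\<dots> = (\<Sum>p\<in>bf_walks u v n. if n = 0 then k else k - 1)"
  proof (intro sum.cong refl)
    fix p assume p: "p \<in> bf_walks u v n"
    show "card {a \<in> out_arcs G u. p = [] \<or> hd p \<noteq> a} = (if n = 0 then k else k - 1)"
    proof (cases p)
      case Nil
      then have "{a \<in> out_arcs G u. p = [] \<or> hd p \<noteq> a} = out_arcs G u" "n = 0"
        using p by (auto simp: bf_walks_def)
      then show ?thesis using u by (simp only: card_out_arcs) simp
    next
      case (Cons a r)
      then have "a \<in> out_arcs G u" "n \<noteq> 0" using p by (auto simp: bf_walks_def awalk_Cons_iff)
      moreover have "{a \<in> out_arcs G u. p = [] \<or> hd p \<noteq> a} = out_arcs G u - {a}"
        using Cons by auto
      ultimately show ?thesis using u by (simp add: card_Diff_singleton card_out_arcs)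
    qed
  qed
  finally show ?thesis by (simp add: mult.commute)
qed

text \<open>Splitting off the first arc reduces the left side to the neighbours of \<open>u\<close>;
  there the induction hypothesis applies, and the transposed recurrence reassembles the right side
  at \<open>u\<close>.\<close>

lemma card_walks_eq_sum:
  assumes "u \<in> verts G" "1 \<le> k"
  shows "real (card (walks u v n))
    = (\<Sum>j\<le>n. tree_walks (real k - 1) n j * real (card (bf_walks u v j)))"
  using assms(1)
proof (induction n arbitrary: u)
  case 0
  have "bf_walks u v 0 = walks u v 0" by (auto simp: bf_walks_def walks_def)
  then show ?case by simp
next
  case (Suc n)
  define X where "X j = (\<Sum>a\<in>out_arcs G u. real (card (bf_walks (head G a) v j)))" for j
  have "real (card (walks u v (Suc n))) = (\<Sum>a\<in>out_arcs G u. real (card (walks (head G a) v n)))"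
    by (simp add: card_walks_Suc Suc.prems)
  also have "\<dots> = (\<Sum>a\<in>out_arcs G u. \<Sum>j\<le>n. tree_walks (real k - 1) n j * real (card (bf_walks (head G a) v j)))"
    by (intro sum.cong refl Suc.IH head_out_arcs)
  also have "\<dots> = (\<Sum>j\<le>n. tree_walks (real k - 1) n j * X j)"
    by (subst sum.swap) (simp add: X_def sum_distrib_left)
  also have "\<dots> = (\<Sum>j\<le>Suc n. tree_walks (real k - 1) (Suc n) j * real (card (bf_walks u v j)))"
  proof (rule tree_walks_sum_recurrence)
    show "X 0 = real (card (bf_walks u v 1))"
      using sum_card_bf_walks_0[OF Suc.prems, of v] by (simp add: X_def flip: of_nat_sum)
    show "X (Suc j) = real (card (bf_walks u v (Suc (Suc j)))) +
        (if j = 0 then real k - 1 + 1 else real k - 1) * real (card (bf_walks u v j))" for j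
      using arg_cong[OF sum_card_bf_walks_Suc[OF Suc.prems, of v j], of real] assms(2)
      by (simp add: X_def of_nat_diff split: if_splits)
  qed
  finally show ?case .
qed

end

subsection \<open>Superharmonic functions\<close>

text \<open>If f is positive and superharmonic for the eigenvalue t + q / t, and f grows along an arc by a
  factor at least y, then f shrinks along each other arc from the same vertex by a factor at least
  1 / (t + 1 / t - y). The map from y to this factor fixes t.\<close>

fun ratio_bound :: "real \<Rightarrow> real \<Rightarrow> nat \<Rightarrow> real" where
  "ratio_bound q t 0 = q / t - (t - sqrt q)"
| "ratio_bound q t (Suc j) = 1 / (t + 1 / t - ratio_bound q t j)"

text \<open>At \<open>t = sqrt q\<close> the step fixes \<open>sqrt q\<close>, with denominator
  \<open>1 / sqrt q\<close>, so continuity carries the limit through any fixed number of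
  steps.\<close>

lemma ratio_bound_tendsto:
  assumes "0 < q"
  shows "((\<lambda>t. ratio_bound q t j) \<longlongrightarrow> sqrt q) (at_right (sqrt q))"
proof (induction j)
  case 0
  have "((\<lambda>t. q / t - (t - sqrt q)) \<longlongrightarrow> q / sqrt q - (sqrt q - sqrt q)) (at_right (sqrt q))"
    using assms by (intro tendsto_intros) auto
  then show ?case using assms by (simp add: real_div_sqrt)
next
  case (Suc j)
  have "((\<lambda>t. 1 / (t + 1 / t - ratio_bound q t j)) \<longlongrightarrow> 1 / (sqrt q + 1 / sqrt q - sqrt q))
      (at_right (sqrt q))"
    using assms by (intro tendsto_intros Suc) auto
  then show ?case by simp
qed

context regular_bidirected_digraph
begin

lemma awalk_map_arev_rev: "awalk u p w \<Longrightarrow> awalk w (map arev (rev p)) u"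
proof (induction p arbitrary: u)
  case Nil
  then show ?case by (auto simp: awalk_Nil_iff)
next
  case (Cons a p)
  then have a: "a \<in> arcs G" "u = tail G a" "awalk w (map arev (rev p)) (head G a)"
    by (auto simp: awalk_Cons_iff)
  then have "awalk (head G a) [arev a] u" by (auto simp: awalk_Cons_iff awalk_Nil_iff)
  with a(3) have "awalk w (map arev (rev p) @ [arev a]) u" by (rule awalk_appendI)
  then show ?case by simp
qed

lemma sum_arcs_split:
  fixes g :: "'b \<Rightarrow> real"
  assumes "e \<in> arcs G"
  shows "sum g (out_arcs G (tail G e)) = g e + sum g (out_arcs G (tail G e) - {e})"
  using assms finite_out_arcs[of "tail G e"] by (intro sum.remove) auto

lemma card_siblings:
  assumes "e \<in> arcs G" "1 \<le> k"
  shows "real (card (out_arcs G (tail G e) - {e})) = real k - 1"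
  using assms by (subst card_Diff_singleton) (auto simp: card_out_arcs of_nat_diff)

text \<open>\<open>l\<close> is chosen before \<open>f\<close>, hence the uniform bound
  \<open>m\<close> on the lengths: only the thresholds of index at most \<open>m\<close> have to
  exceed 1, which is possible near \<open>sqrt q > 1\<close>. The condition
  \<open>hd c \<noteq> e\<close> makes the walk leave along an arc on which \<open>f\<close>
  decreases.\<close>

lemma superharmonic_not_arbitrarily_close:
  assumes k: "3 \<le> k" and ne: "arcs G \<noteq> {}"
    and cyc: "\<And>e. e \<in> arcs G \<Longrightarrow>
      \<exists>c. awalk (tail G e) c (tail G e) \<and> c \<noteq> [] \<and> length c \<le> m \<and> hd c \<noteq> e \<and> backtrack_free arev c"
  shows "\<exists>l > 2 * sqrt (real k - 1). \<nexists>f. (\<forall>x\<in>verts G. 0 < f x) \<and>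
    (\<forall>x\<in>verts G. (\<Sum>a\<in>out_arcs G x. f (head G a)) \<le> l * f x)"
proof -
  define q where "q = real k - 1"
  have q: "2 \<le> q" using k by (simp add: q_def)
  have sq: "1 < sqrt q" using q by simp
  have "eventually (\<lambda>t. \<forall>j\<in>{..m}. 1 < ratio_bound q t j) (at_right (sqrt q))"
    using order_tendstoD(1)[OF ratio_bound_tendsto sq] q
    by (subst eventually_ball_finite_distrib) auto
  moreover have "eventually (\<lambda>t. sqrt q < t) (at_right (sqrt q))"
    by (simp add: eventually_at_right_less)
  ultimately have "eventually (\<lambda>t. sqrt q < t \<and> (\<forall>j\<in>{..m}. 1 < ratio_bound q t j)) (at_right (sqrt q))"
    by eventually_elim auto
  then have "\<exists>t. sqrt q < t \<and> (\<forall>j\<in>{..m}. 1 < ratio_bound q t j)"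
    by (rule eventually_happens'[rotated]) (rule trivial_limit_at_right_real)
  then obtain t where t: "sqrt q < t" and bound: "\<And>j. j \<le> m \<Longrightarrow> 1 < ratio_bound q t j"
    by auto
  have t0: "0 < t" using t sq by linarith
  define l where "l = t + q / t"
  have "sqrt q + q / sqrt q < l" unfolding l_def using t q by (intro add_divide_strict_mono) auto
  then have "2 * sqrt q < l" using q by (simp add: real_div_sqrt)
  moreover have False if pos: "\<And>x. x \<in> verts G \<Longrightarrow> 0 < f x"
    and sup: "\<And>x. x \<in> verts G \<Longrightarrow> (\<Sum>a\<in>out_arcs G x. f (head G a)) \<le> l * f x" for f
  proof -
    define r where "r e = f (head G e) / f (tail G e)" for e
    have r_pos: "0 < r e" if "e \<in> arcs G" for e using that pos by (simp add: r_def)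
    have r_arev: "r (arev e) = 1 / r e" if "e \<in> arcs G" for e using that by (simp add: r_def)
    have r_sum: "r e + sum r (out_arcs G (tail G e) - {e}) \<le> l" if e: "e \<in> arcs G" for e
    proof -
      have "sum r (out_arcs G (tail G e)) = (\<Sum>a\<in>out_arcs G (tail G e). f (head G a)) / f (tail G e)"
        by (auto simp: sum_divide_distrib r_def intro!: sum.cong)
      also have "\<dots> \<le> l" using sup[of "tail G e"] pos[of "tail G e"] e by (simp add: divide_le_eq)
      finally show ?thesis using sum_arcs_split[OF e, of r] by simp
    qed
    have sib_pos: "0 \<le> sum r A" if "A \<subseteq> out_arcs G x" for A x
      using that r_pos by (intro sum_nonneg less_imp_le) auto
    have r_le: "r e \<le> l" if "e \<in> arcs G" for e
      using r_sum[OF that] sib_pos[OF Diff_subset, of "tail G e" "{e}"] by linarith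
    define R where "R = (SUP e\<in>arcs G. r e)"
    have bdd: "bdd_above (r ` arcs G)" using r_le by (auto simp: bdd_above_def)
    have r_le_R: "r e \<le> R" if "e \<in> arcs G" for e unfolding R_def using bdd that by (rule cSUP_upper2) simp
    have R_pos: "0 < R" using ne r_pos r_le_R by (meson all_not_in_conv less_le_trans)
    \<comment> \<open>Reversing an arc inverts its ratio, so the supremum also bounds the ratios
      from below.\<close>
    have r_ge: "1 / R \<le> r e" if "e \<in> arcs G" for e
      using r_le_R[of "arev e"] r_arev[OF that] that r_pos[OF that] R_pos by (simp add: field_simps)
    \<comment> \<open>The \<open>q\<close> other arcs at the tail contribute at least
      \<open>q / R\<close>. In the supremum this gives \<open>R * R + q \<le> l * R\<close>, so
      \<open>R\<close> lies between the roots \<open>q / t\<close> and \<open>t\<close>.\<close>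
    have "r e \<le> l - q / R" if e: "e \<in> arcs G" for e
    proof -
      have "q / R = (\<Sum>a\<in>out_arcs G (tail G e) - {e}. 1 / R)"
        using card_siblings[OF e] k by (simp add: q_def)
      also have "\<dots> \<le> sum r (out_arcs G (tail G e) - {e})" by (intro sum_mono r_ge) auto
      finally show ?thesis using r_sum[OF e] by simp
    qed
    then have "R \<le> l - q / R" unfolding R_def by (intro cSUP_least ne)
    then have "R * R + q \<le> l * R" using R_pos by (simp add: field_simps)
    moreover have "(R - t) * (R - q / t) = R * R + q - l * R"
      using t0 by (simp add: l_def field_simps)
    ultimately have "(R - t) * (R - q / t) \<le> 0" by simp
    moreover have "q / t < t"
    proof -
      have "sqrt q * sqrt q < t * t" using t t0 q by (intro mult_strict_mono) auto
      then show ?thesis using q t0 by (simp add: field_simps)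
    qed
    ultimately have R: "q / t \<le> R" "R \<le> t" by (auto simp: mult_le_0_iff)
    \<comment> \<open>Of the total \<open>l = t + q / t\<close>, \<open>e\<close> takes at least
      \<open>ratio_bound q t j\<close> and each of the \<open>q - 1\<close> arcs other than
      \<open>e\<close> and \<open>a\<close> at least \<open>1 / t\<close>. At most
      \<open>t + 1 / t - ratio_bound q t j\<close> is left for \<open>a\<close>.\<close>
    have r_step: "ratio_bound q t (Suc j) \<le> r (arev a)"
      if e: "e \<in> arcs G" "ratio_bound q t j \<le> r e" and a: "a \<in> arcs G" "tail G a = tail G e" "a \<noteq> e"
      for e a j
    proof -
      have fin: "finite (out_arcs G (tail G e) - {e})" using e finite_out_arcs by auto
      have "(q - 1) / t = (\<Sum>b\<in>out_arcs G (tail G e) - {e} - {a}. 1 / t)"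
      proof -
        have "Suc (card (out_arcs G (tail G e) - {e} - {a})) = card (out_arcs G (tail G e) - {e})"
          using a fin by (intro card_Suc_Diff1) auto
        then have "real (card (out_arcs G (tail G e) - {e} - {a})) = q - 1"
          using card_siblings[OF e(1)] k by (simp add: q_def flip: of_nat_Suc)
        then show ?thesis by simp
      qed
      also have "\<dots> \<le> sum r (out_arcs G (tail G e) - {e} - {a})"
      proof (rule sum_mono)
        fix b assume "b \<in> out_arcs G (tail G e) - {e} - {a}"
        then have "1 / R \<le> r b" by (intro r_ge) auto
        moreover have "1 / t \<le> 1 / R" using R R_pos by (simp add: frac_le)
        ultimately show "1 / t \<le> r b" by linarith
      qed
      finally have "r a + (q - 1) / t \<le> sum r (out_arcs G (tail G e) - {e})"
        using a fin by (subst sum.remove[of _ a]) auto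
      then have "r a \<le> l - (q - 1) / t - ratio_bound q t j" using r_sum[OF e(1)] e(2) by linarith
      also have "\<dots> = t + 1 / t - ratio_bound q t j" by (simp add: l_def diff_divide_distrib)
      finally have "1 / (t + 1 / t - ratio_bound q t j) \<le> 1 / r a"
        using r_pos[OF a(1)] by (intro divide_left_mono) auto
      then show ?thesis using r_arev a by simp
    qed
    \<comment> \<open>After the first arc \<open>a\<close>, its reverse takes over the role of
      \<open>e\<close> with index \<open>Suc j\<close>: its ratio is large, and the walk, having no
      backtrack, does not continue along it.\<close>
    have decrease: "f w < f (tail G e)"
      if "e \<in> arcs G" "ratio_bound q t j \<le> r e" "awalk (tail G e) p w" "p \<noteq> []" "hd p \<noteq> e"
        "backtrack_free arev p" "j + length p \<le> m" for e j p w
      using that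
    proof (induction p arbitrary: e j)
      case (Cons a p)
      then have a: "a \<in> arcs G" "tail G a = tail G e" "a \<noteq> e" "awalk (head G a) p w"
        by (auto simp: awalk_Cons_iff)
      have st: "ratio_bound q t (Suc j) \<le> r (arev a)"
        by (rule r_step[OF Cons.prems(1,2) a(1-3)])
      moreover have "1 < ratio_bound q t (Suc j)" using Cons.prems by (intro bound) auto
      ultimately have "1 < r (arev a)" by linarith
      then have less: "f (head G a) < f (tail G e)"
        using a pos[of "head G a"] by (simp add: r_def)
      show ?case
      proof (cases "p = []")
        case True
        then show ?thesis using a(4) less by (simp add: awalk_Nil_iff)
      next
        case False
        have "f w < f (tail G (arev a))"
          using Cons.prems a False st
          by (intro Cons.IH[of "arev a" "Suc j"]) (auto simp: backtrack_free_Cons)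
        then show ?thesis using a less by simp
      qed
    qed simp
    \<comment> \<open>The slack \<open>t - sqrt q\<close> puts the starting value strictly below
      \<open>q / t \<le> R\<close>, so some arc exceeds it even if the supremum is not
      attained.\<close>
    have "ratio_bound q t 0 < R" using R t by simp
    then obtain e where e: "e \<in> arcs G" "ratio_bound q t 0 < r e"
      unfolding R_def using less_cSUP_iff[OF ne bdd] by blast
    obtain c where c: "awalk (tail G e) c (tail G e)" "c \<noteq> []" "length c \<le> m" "hd c \<noteq> e"
      "backtrack_free arev c" using cyc[OF e(1)] by blast
    have "f (tail G e) < f (tail G e)" using e c by (intro decrease[of e 0 c]) auto
    then show False by simp
  qed
  ultimately show ?thesis unfolding q_def by (intro exI[of _ l]) blast
qed

section \<open>The Green function\<close>

text \<open>\<open>f x\<close> sums \<open>z ^ n\<close> over the walks from \<open>x\<close> to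
  \<open>v\<close>. Splitting off the first arc gives an equality up to the term of length 0, and
  dropping that term leaves the inequality.\<close>

lemma superharmonic_exists:
  assumes conn: "Digraph_Component.connected G" and v: "v \<in> verts G" and z: "0 < z"
    and sm: "summable (\<lambda>n. real (card (walks v v n)) * z ^ n)"
  shows "\<exists>f. (\<forall>x\<in>verts G. 0 < f x) \<and>
    (\<forall>x\<in>verts G. (\<Sum>a\<in>out_arcs G x. f (head G a)) \<le> 1 / z * f x)"
proof -
  have "symmetric G"
    unfolding symmetric_conv by (metis arev_in_arcs head_arev tail_arev)
  then have sc: "strongly_connected G" using conn by (rule symmetric_connected_imp_strongly_connected)
  have ex_walk: "\<exists>p. awalk x p y" if "x \<in> verts G" "y \<in> verts G" for x y
    using sc that unfolding strongly_connected_def reachable_awalk by blast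
  define W where "W x n = real (card (walks x v n)) * z ^ n" for x n
  have W0: "0 \<le> W x n" for x n using z by (simp add: W_def)
  have sW: "summable (W x)" if x: "x \<in> verts G" for x
  proof -
    obtain p where p: "awalk v p x" using ex_walk v x by blast
    let ?d = "length p"
    \<comment> \<open>Prefixing \<open>p\<close> embeds the walks from \<open>x\<close> to
      \<open>v\<close> into the cycles at \<open>v\<close> that are longer by
      \<open>?d\<close>.\<close>
    have "summable (\<lambda>n. inverse (z ^ ?d) * (real (card (walks v v (n + ?d))) * z ^ (n + ?d)))"
      by (intro summable_mult summable_ignore_initial_segment sm)
    then have "summable (\<lambda>n. real (card (walks v v (n + ?d))) * z ^ n)"
      using z by (simp add: power_add field_simps)
    then show ?thesis
    proof (rule summable_comparison_test'[where N = 0])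
      fix n :: nat
      have "(@) p ` walks x v n \<subseteq> walks v v (n + ?d)"
        using p by (auto simp: walks_def intro: awalk_appendI simp del: awalk_append_iff)
      then have "card ((@) p ` walks x v n) \<le> card (walks v v (n + ?d))"
        by (intro card_mono finite_walks v)
      then have "card (walks x v n) \<le> card (walks v v (n + ?d))"
        by (subst (asm) card_image) (auto simp: inj_on_def)
      then show "norm (W x n) \<le> real (card (walks v v (n + ?d))) * z ^ n"
        using z by (simp add: W_def mult_right_mono)
    qed
  qed
  define f where "f x = suminf (W x)" for x
  have "0 < f x" if x: "x \<in> verts G" for x
  proof -
    obtain p where "awalk x p v" using ex_walk v x by blast
    then have "p \<in> walks x v (length p)" by (simp add: walks_def)
    then have "0 < card (walks x v (length p))" using finite_walks[OF x] by (auto simp: card_gt_0_iff)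
    then have "0 < W x (length p)" using z by (simp add: W_def)
    then show ?thesis unfolding f_def using sW[OF x] W0 by (intro suminf_pos2) auto
  qed
  moreover have "(\<Sum>a\<in>out_arcs G x. f (head G a)) \<le> 1 / z * f x" if x: "x \<in> verts G" for x
  proof -
    have W_Suc: "W x (Suc n) = z * (\<Sum>a\<in>out_arcs G x. W (head G a) n)" for n
      by (simp add: W_def card_walks_Suc[OF x] sum_distrib_left sum_distrib_right mult_ac)
    have "(\<Sum>a\<in>out_arcs G x. f (head G a)) = (\<Sum>n. \<Sum>a\<in>out_arcs G x. W (head G a) n)"
      unfolding f_def by (intro suminf_sum[symmetric] sW head_out_arcs)
    also have "\<dots> = (\<Sum>n. 1 / z * W x (Suc n))" using z by (simp add: W_Suc)
    also have "\<dots> = 1 / z * (\<Sum>n. W x (Suc n))"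
      using sW[OF x] by (intro suminf_mult) (simp add: summable_Suc_iff)
    also have "\<dots> \<le> 1 / z * f x"
      using suminf_split_head[OF sW[OF x]] W0[of x 0] z by (simp add: f_def divide_right_mono)
    finally show ?thesis .
  qed
  ultimately show ?thesis by blast
qed

section \<open>Cycles in vertex-transitive graphs\<close>

text \<open>Automorphisms carry one cycle to every vertex, with the same length. Since they commute
  with \<open>arev\<close> and are injective on arcs, the images contain no arc together with its
  reverse either.\<close>

lemma transitive_cycles:
  assumes conn: "Digraph_Component.connected G" and trans: "vertex_transitive G arev"
    and nt: "\<not> undirected_tree G arev"
  obtains m where "\<And>x. x \<in> verts G \<Longrightarrow>
    \<exists>c. awalk x c x \<and> c \<noteq> [] \<and> length c = m \<and> (\<forall>a\<in>set c. arev a \<notin> set c)"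
proof -
  obtain p u where p: "awalk u p u" "p \<noteq> []" "\<forall>a\<in>set p. arev a \<notin> set p"
    using conn nt unfolding undirected_tree_def cycle_def by blast
  have u: "u \<in> verts G" and p_arcs: "set p \<subseteq> arcs G" using p(1) by auto
  show thesis
  proof (rule that[of "length p"])
    fix x assume "x \<in> verts G"
    then obtain h where h: "graph_automorphism G arev h" "iso_verts h u = x"
      using trans u unfolding vertex_transitive_def by blast
    have iso: "digraph_isomorphism h" "app_iso h G = G"
      "\<And>a. a \<in> arcs G \<Longrightarrow> iso_arcs h (arev a) = arev (iso_arcs h a)"
      using h(1) by (auto simp: graph_automorphism_def)
    have "awalk x (map (iso_arcs h) p) x"
      using awalk_app_isoI[OF p(1) iso(1)] h(2) iso(2) by simp
    moreover have "arev a \<notin> set (map (iso_arcs h) p)" if a: "a \<in> set (map (iso_arcs h) p)" for a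
    proof
      assume "arev a \<in> set (map (iso_arcs h) p)"
      then obtain b c where b: "b \<in> set p" "c \<in> set p" "a = iso_arcs h b" "arev a = iso_arcs h c"
        using a unfolding set_map by blast
      then have "iso_arcs h (arev b) = iso_arcs h c" using iso(3) p_arcs by auto
      then have "arev b = c"
        using digraph_isomorphism_inj_on_arcs[OF iso(1)] b p_arcs by (auto dest!: inj_onD)
      then show False using p(3) b by auto
    qed
    ultimately show "\<exists>c. awalk x c x \<and> c \<noteq> [] \<and> length c = length p \<and> (\<forall>a\<in>set c. arev a \<notin> set c)"
      using p(2) by (intro exI[of _ "map (iso_arcs h) p"]) auto
  qed
qed

text \<open>A cycle that begins with \<open>e\<close> is run backwards. It then begins with the
  reverse of the last arc of \<open>c\<close>, which is not in \<open>c\<close> and hence is not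
  \<open>e\<close>.\<close>

lemma reduced_cycle_avoiding:
  assumes c: "awalk x c x" "c \<noteq> []" "\<forall>a\<in>set c. arev a \<notin> set c"
  shows "\<exists>c'. awalk x c' x \<and> c' \<noteq> [] \<and> length c' = length c \<and> hd c' \<noteq> e \<and> backtrack_free arev c'"
proof (cases "hd c = e")
  case False
  then show ?thesis using c by (intro exI[of _ c]) (auto intro: backtrack_freeI_set)
next
  case True
  let ?c = "map arev (rev c)"
  have "hd ?c = arev (last c)" using c(2) by (simp add: hd_map hd_rev)
  then have "hd ?c \<noteq> e" using True c by (metis hd_in_set last_in_set)
  moreover have "backtrack_free arev ?c" using c(3) by (intro backtrack_freeI_set) auto
  ultimately show ?thesis using awalk_map_arev_rev[OF c(1)] c(2) by (intro exI[of _ ?c]) auto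
qed

lemma awalk_concat_replicate: "awalk x c x \<Longrightarrow> awalk x (concat (replicate n c)) x"
  by (induction n) (auto simp: awalk_Nil_iff intro: awalk_appendI simp del: awalk_append_iff)

text \<open>Otherwise the series of cycles would converge at \<open>1 / l\<close> for every
  \<open>l > 2 * sqrt (real k - 1)\<close>, and its Green function would contradict the choice of
  one such \<open>l\<close>.\<close>

lemma cycle_growth_gt:
  assumes k: "3 \<le> k" and v: "v \<in> verts G" and conn: "Digraph_Component.connected G"
    and trans: "vertex_transitive G arev" and nt: "\<not> undirected_tree G arev"
  shows "2 * sqrt (real k - 1) < cycle_growth G v"
proof -
  obtain m where m: "\<And>x. x \<in> verts G \<Longrightarrow>
      \<exists>c. awalk x c x \<and> c \<noteq> [] \<and> length c = m \<and> (\<forall>a\<in>set c. arev a \<notin> set c)"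
    using transitive_cycles[OF conn trans nt] by blast
  have "\<exists>l > 2 * sqrt (real k - 1). \<nexists>f. (\<forall>x\<in>verts G. 0 < f x) \<and>
    (\<forall>x\<in>verts G. (\<Sum>a\<in>out_arcs G x. f (head G a)) \<le> l * f x)"
  proof (rule superharmonic_not_arbitrarily_close[OF k])
    obtain c where "awalk v c v" "c \<noteq> []" using m[OF v] by blast
    then show "arcs G \<noteq> {}" by (cases c) (auto simp: awalk_Cons_iff)
    fix e assume "e \<in> arcs G"
    then obtain c where "awalk (tail G e) c (tail G e)" "c \<noteq> []" "length c = m"
      "\<forall>a\<in>set c. arev a \<notin> set c" using m[of "tail G e"] by auto
    then show "\<exists>c. awalk (tail G e) c (tail G e) \<and> c \<noteq> [] \<and> length c \<le> m \<and> hd c \<noteq> e \<and> backtrack_free arev c"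
      using reduced_cycle_avoiding[of "tail G e" c e] by force
  qed
  then obtain l where l: "2 * sqrt (real k - 1) < l" and
    no: "\<nexists>f. (\<forall>x\<in>verts G. 0 < f x) \<and> (\<forall>x\<in>verts G. (\<Sum>a\<in>out_arcs G x. f (head G a)) \<le> l * f x)"
    by blast
  have "0 \<le> sqrt (real k - 1)" using k by simp
  then have l0: "0 < l" using l by linarith
  show ?thesis
  proof (rule ccontr)
    assume "\<not> ?thesis"
    then have "cycle_growth G v < l" using l by linarith
    then have "1 / l * cycle_growth G v < 1" using l0 by simp
    then have "summable (\<lambda>n. real (card (walks v v n)) * (1 / l) ^ n)"
      using l0 card_walks_le[OF v, of v] unfolding cycle_growth_def num_cycles_def walks_def
      by (intro summable_limsup_root(1)[where K = "real k"]) (auto simp flip: of_nat_power)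
    then show False using superharmonic_exists[OF conn v, of "1 / l"] l0 no by simp
  qed
qed

text \<open>The powers of \<open>c\<close> have no backtracks, not even where two copies meet,
  because no arc of \<open>c\<close> has its reverse in \<open>c\<close>. So the counts do not tend
  to 0 and their series diverges at 1.\<close>

lemma backtrack_free_cycle_growth_ge_1:
  assumes v: "v \<in> verts G" and c: "awalk v c v" "c \<noteq> []" "\<forall>a\<in>set c. arev a \<notin> set c"
  shows "1 \<le> backtrack_free_cycle_growth G arev v"
proof (rule ccontr)
  assume "\<not> ?thesis"
  then have "summable (\<lambda>n. real (card (bf_walks v v n)) * 1 ^ n)"
    using card_bf_walks_le[OF v, of v]
    unfolding backtrack_free_cycle_growth_def num_backtrack_free_cycles_def bf_walks_def
    by (intro summable_limsup_root(1)[where K = "real k"]) (auto simp flip: of_nat_power)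
  then have "(\<lambda>n. real (card (bf_walks v v n))) \<longlonglongrightarrow> 0" using summable_LIMSEQ_zero by fastforce
  then have "eventually (\<lambda>n. real (card (bf_walks v v n)) < 1) sequentially"
    by (rule order_tendstoD) simp
  then obtain N where N: "\<And>n. N \<le> n \<Longrightarrow> real (card (bf_walks v v n)) < 1"
    by (auto simp: eventually_sequentially)
  define p where "p = concat (replicate N c)"
  have "length p = N * length c" by (simp add: p_def length_concat sum_list_replicate)
  then have "N \<le> length p" using c(2) by (cases c) auto
  moreover have "set p \<subseteq> set c" by (auto simp: p_def)
  then have "backtrack_free arev p" using c(3) by (intro backtrack_freeI_set) auto
  then have "p \<in> bf_walks v v (length p)"
    using awalk_concat_replicate[OF c(1)] by (simp add: bf_walks_def p_def)
  then have "card (bf_walks v v (length p)) \<noteq> 0" using finite_bf_walks[OF v] by auto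
  ultimately show False using N[of "length p"] by simp
qed

end

theorem theorem5p1:
  fixes G :: "('a, 'b) pre_digraph" and arev :: "'b \<Rightarrow> 'b"
    and k :: nat and v :: 'a and \<rho> \<gamma> :: real
  assumes "regular_graph G arev k"
    and "k \<ge> 2"
    and "v \<in> verts G"
    and "\<rho> = cycle_growth G v"
    and "\<gamma> = backtrack_free_cycle_growth G arev v"
  shows "\<rho>\<^sup>2 - 4 * (real k - 1) \<ge> 0
    \<and> \<gamma> \<le> (\<rho> + sqrt (\<rho>\<^sup>2 - 4 * (real k - 1))) / 2
    \<and> (\<rho> > 2 * sqrt (real k - 1)
        \<longrightarrow> \<gamma> = (\<rho> + sqrt (\<rho>\<^sup>2 - 4 * (real k - 1))) / 2)
    \<and> (Digraph_Component.connected G \<and> vertex_transitive G arev \<and> simple_graph G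
          \<and> \<not> undirected_tree G arev
        \<longrightarrow> (k \<noteq> 2 \<longrightarrow> \<rho> > 2 * sqrt (real k - 1))
          \<and> \<gamma> = (\<rho> + sqrt (\<rho>\<^sup>2 - 4 * (real k - 1))) / 2)"
proof -
  interpret bidirected_digraph G arev using assms(1) by (simp add: regular_graph_def)
  interpret regular_bidirected_digraph G arev k
    using assms(1) by unfold_locales (auto simp: regular_graph_def out_degree_def)
  note k = assms(2) and v = assms(3)
  define q where "q = real k - 1"
  have q: "1 \<le> q" using k by (simp add: q_def)
  define C where "C n = real (card (walks v v n))" for n
  define b where "b n = real (card (bf_walks v v n))" for n
  have \<rho>: "\<rho> = real_of_ereal (limsup (\<lambda>n. ereal (root n (C n))))"
    by (simp add: assms(4) cycle_growth_def num_cycles_def C_def walks_def)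
  have \<gamma>: "\<gamma> = real_of_ereal (limsup (\<lambda>n. ereal (root n (b n))))"
    by (simp add: assms(5) backtrack_free_cycle_growth_def num_backtrack_free_cycles_def b_def bf_walks_def)
  have C: "0 \<le> C n" "C n \<le> real k ^ n" for n
    using card_walks_le[OF v, of v n] by (auto simp: C_def simp flip: of_nat_power)
  have b: "0 \<le> b n" "b n \<le> real k ^ n" for n
    using card_bf_walks_le[OF v, of v n] by (auto simp: b_def simp flip: of_nat_power)
  have "bf_walks v v 0 = {[]}" using v by (auto simp: bf_walks_def awalk_Nil_iff)
  then have b_0: "b 0 = 1" by (simp add: b_def)
  have C_eq: "C n = (\<Sum>j\<le>n. tree_walks q n j * b j)" for n
    unfolding C_def b_def q_def using v k by (intro card_walks_eq_sum) auto
  note growth = tree_transform_growth[OF q b C of_nat_0_le_iff b_0 C_eq, folded \<rho> \<gamma>]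
  have "(2 * sqrt q)\<^sup>2 \<le> \<rho>\<^sup>2" using growth(1) q by (intro power_mono) auto
  then have disc: "0 \<le> \<rho>\<^sup>2 - 4 * q" using q by (simp add: power_mult_distrib)
  have "(k \<noteq> 2 \<longrightarrow> \<rho> > 2 * sqrt q) \<and> \<gamma> = (\<rho> + sqrt (\<rho>\<^sup>2 - 4 * q)) / 2"
    if conn: "Digraph_Component.connected G" and trans: "vertex_transitive G arev"
      and nt: "\<not> undirected_tree G arev"
  proof (cases "k = 2")
    case False
    then have "\<rho> > 2 * sqrt q"
      unfolding q_def assms(4) using k by (intro cycle_growth_gt v conn trans nt) auto
    then show ?thesis using growth(3) by simp
  next
    \<comment> \<open>Here \<open>q = 1\<close>, and \<open>\<rho>\<close> lies between
      \<open>2 * sqrt q\<close> and \<open>k\<close>, so it is exactly 2 and the strict criterion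
      fails. The claimed value is 1: the general estimate bounds \<open>\<gamma>\<close> from above,
      the powers of a cycle from below.\<close>
    case True
    have "\<rho> \<le> 2" using limsup_root_bounded(2)[OF C] True by (simp add: \<rho>)
    moreover have "2 \<le> \<rho>" using growth(1) True by (simp add: q_def)
    ultimately have "\<rho> = 2" by simp
    moreover have "1 \<le> \<gamma>"
      using transitive_cycles[OF conn trans nt] v
      unfolding assms(5) by (metis backtrack_free_cycle_growth_ge_1)
    ultimately show ?thesis using growth(2) True by (simp add: q_def)
  qed
  then show ?thesis using disc growth(2,3) unfolding q_def by blast
qed

end
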